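(* Let $\Omega$ be a Hausdorff space, let $L:\Omega\times\Omega\to[0,\infty)$ be a continuous negative definite kernel, and let $\mathcal{P}_L$ be the class of the Radon probability measures $P$ on $\Omega$ for which $\mathbb{E}_P\, L(Y,Y')$ is finite, where $Y$ and $Y'$ are independent with distribution $P$. Let $S$ be the kernel score associated with $L$, that is, $$S(Q,y') = \mathbb{E}_Q\, L(Z,y') - \tfrac12\, \mathbb{E}_Q\, L(Z,Z'), \qquad Q\in\mathcal{P}_L,\ y'\in\Omega,$$ where $Z$ and $Z'$ are independent with distribution $Q$. Let $P\in\mathcal{P}_L$ and define $\alpha \equiv \inf_{Q\in\mathcal{P}_L} \mathbb{E}_P\, S(Q,Y')$, where $Y'$ has distribution $P$. Then $$\alpha = \mathbb{E}_P\, S(P,Y') \;\leq\; \beta \equiv \mathbb{E}_P\, S(\delta_Y,Y') = 2\alpha,$$ where $Y$ and $Y'$ are independent with distribution $P$, and $\delta_Y$ is the point (Dirac) random probability measure in $Y$.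
   Context: A Hausdorff space $\Omega$ is equipped with its Borel $\sigma$-algebra. A function $L:\Omega\times\Omega\to[0,\infty)$ is a negative definite kernel if it is symmetric in its arguments, $L(y,y)=0$ for all $y\in\Omega$, and $$\sum_{i=1}^n\sum_{j=1}^n a_i a_j\, L(y_i,y_j)\leq 0$$ for all finite systems of points $y_1,\ldots,y_n\in\Omega$ and coefficients $a_1,\ldots,a_n\in\mathbb{R}$ such that $a_1+\cdots+a_n=0$. For a fixed probability measure $Q$, the expectation $\mathbb{E}_P\, S(Q,Y')$ is taken over $Y'$ with distribution $P$; the expectation $\mathbb{E}_P\, S(\delta_Y,Y')$ is taken over the independent pair $(Y,Y')$, with $S(\delta_y,\cdot)$ being the score of the Dirac measure at $y$. *)

theory Defs
  imports "HOL-Probability.Probability"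
begin

definition neg_def_kernel :: "('a \<Rightarrow> 'a \<Rightarrow> real) \<Rightarrow> bool" where
  "neg_def_kernel L \<longleftrightarrow>
     (\<forall>x y. 0 \<le> L x y) \<and>
     (\<forall>x y. L x y = L y x) \<and>
     (\<forall>y. L y y = 0) \<and>
     (\<forall>(n::nat) (y :: nat \<Rightarrow> 'a) (a :: nat \<Rightarrow> real).
        (\<Sum>i<n. a i) = 0 \<longrightarrow> (\<Sum>i<n. \<Sum>j<n. a i * a j * L (y i) (y j)) \<le> 0)"

definition radon_prob_measure :: "'a::t2_space measure \<Rightarrow> bool" where
  "radon_prob_measure P \<longleftrightarrow>
     prob_space P \<and> sets P = sets borel \<and>
     (\<forall>B\<in>sets borel. emeasure P B = (SUP K\<in>{K. compact K \<and> K \<subseteq> B}. emeasure P K))"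

text \<open>
  The law of an independent pair with common distribution \<open>P\<close>. On a general Hausdorff space,
  a continuous function of two variables need not be measurable for the product
  \<open>borel \<Otimes>\<^sub>M borel\<close> of the Borel sigma-algebras, and the Bochner integral of a non-measurable
  function is \<open>0\<close> by convention. If \<open>P\<close> is Radon, a continuous function is measurable for the
  completed product measure: it is product-measurable on \<open>K \<times> K\<close> for compact \<open>K\<close>
  (Stone-Weierstrass), and countably many such sets cover almost everything.
\<close>

definition iid_pair :: "'a measure \<Rightarrow> ('a \<times> 'a) measure" where
  "iid_pair P = completion (P \<Otimes>\<^sub>M P)"

definition kernel_class :: "('a::t2_space \<Rightarrow> 'a \<Rightarrow> real) \<Rightarrow> 'a measure set" where
  "kernel_class L =
     {P. radon_prob_measure P \<and> integrable (iid_pair P) (\<lambda>(y, y'). L y y')}"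

definition kernel_score :: "('a::t2_space \<Rightarrow> 'a \<Rightarrow> real) \<Rightarrow> 'a measure \<Rightarrow> 'a \<Rightarrow> real" where
  "kernel_score L Q y' =
     (\<integral>z. L z y' \<partial>Q) - 1 / 2 * (\<integral>(z, z'). L z z' \<partial>iid_pair Q)"

end

theory Submission
  imports Defs
begin

text \<open>
  Write \<open>g\<^sub>Q(y) = E\<^sub>Q L(Z, y)\<close> for the potential of \<open>Q\<close> and \<open>I(Q, P) = E\<^sub>P g\<^sub>Q\<close>. Then
  \<open>E\<^sub>P S(Q, Y') = I(Q, P) - I(Q, Q) / 2\<close>, which is \<open>I(P, P) / 2\<close> for \<open>Q = P\<close>. That no \<open>Q\<close> does
  better is the nonnegativity of the energy distance,
  \<open>I(P, P) + I(Q, Q) \<le> 2 * I(Q, P)\<close> (lemma \<open>energy_inequality\<close>). Since the diagonal of \<open>L\<close>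
  vanishes, \<open>S(\<delta>\<^sub>y, y') = L(y, y')\<close>, so that \<open>\<beta> = I(P, P)\<close>, which is twice \<open>\<alpha>\<close> and nonnegative.

  The energy inequality comes from sampling: apply negative definiteness to \<open>n\<close> independent points
  from \<open>Q\<close> with weight 1 and \<open>n\<close> independent points from \<open>P\<close> with weight -1, and take
  expectations. The zero diagonal removes the terms with a repeated point, and what is left is
  \<open>n * (n - 1) * (I(P, P) + I(Q, Q)) \<le> 2 * n\<^sup>2 * I(Q, P)\<close>; let \<open>n\<close> tend to infinity.
  The expectation is not taken on the product space, where \<open>L\<close> need not be measurable. The points
  are integrated out one after the other (lemma \<open>neg_def_integrated\<close>): each step only integrates
  a section \<open>L(\<sqdot>, y)\<close> or a potential, and both are Borel. Integrating the sample from \<open>Q\<close> first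
  makes the mixed term \<open>E\<^sub>P g\<^sub>Q\<close>, so that no exchange of integrals over \<open>P\<close> and \<open>Q\<close> occurs.

  That sections and potentials are integrable, and potentials measurable, rests on negative
  definiteness for three points (lemma \<open>quasi_triangle\<close>), a form of the triangle inequality for \<open>\<surd>L\<close>.
\<close>

section \<open>Negative definite kernels\<close>

locale continuous_neg_def_kernel =
  fixes L :: "'a::t2_space \<Rightarrow> 'a \<Rightarrow> real"
  assumes continuous: "continuous_on UNIV (\<lambda>(x, y). L x y)"
    and neg_def: "neg_def_kernel L"
begin

lemma nonneg: "0 \<le> L x y" and commute: "L x y = L y x" and diag: "L x x = 0"
  using neg_def unfolding neg_def_kernel_def by auto

lemma neg_def_sum:
  "(\<Sum>i<n. a i) = 0 \<Longrightarrow> (\<Sum>i<n. \<Sum>j<n. a i * a j * L (y i) (y j)) \<le> 0"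
  for n :: nat
  using neg_def by (simp add: neg_def_kernel_def)

lemma continuous_on_left: "continuous_on UNIV (\<lambda>z. L z y)"
  using continuous_on_compose2[OF continuous, of UNIV "\<lambda>z. (z, y)"]
  by (simp add: continuous_on_Pair)

text \<open>
  The map \<open>\<surd>L\<close> is a semimetric, and this is its triangle inequality after squaring, with
  \<open>2 * \<surd>(L z x * L y x)\<close> estimated by \<open>L z x / s + s * L y x\<close>. This form stays linear in \<open>L z y\<close>
  and \<open>L z x\<close>, so it can be integrated over \<open>z\<close>; a large \<open>s\<close> makes the first factor close to 1.
\<close>
lemma quasi_triangle:
  assumes "s > 0"
  shows "L z y \<le> (1 + 1 / s) * L z x + (1 + s) * L y x"
proof -
  \<comment> \<open>The weights 1, \<open>s\<close> and \<open>- (1 + s)\<close> give only the pair \<open>z\<close>, \<open>y\<close> a positive coefficient, which bounds \<open>L z y\<close> from above.\<close>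
  define p where "p i = (if i = 0 then z else if i = 1 then y else x)" for i :: nat
  define a where "a i = (if i = 0 then 1 else if i = 1 then s else - (1 + s))" for i :: nat
  have "(\<Sum>i<3. a i) = 0"
    by (simp add: a_def eval_nat_numeral)
  from neg_def_sum[OF this, of p]
  have "s * L z y \<le> (1 + s) * L z x + s * (1 + s) * L y x"
    by (simp add: a_def p_def eval_nat_numeral diag commute[of y z] commute[of x z] commute[of x y]
        algebra_simps)
  also have "\<dots> = s * ((1 + 1 / s) * L z x + (1 + s) * L y x)"
    using assms by (simp add: field_simps)
  finally show ?thesis
    using assms by simp
qed

section \<open>Potentials of measures of finite energy\<close>

definition potential :: "'a measure \<Rightarrow> 'a \<Rightarrow> real" where
  "potential Q y = (\<integral>z. L z y \<partial>Q)"

lemma kernel_classD: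
  assumes "Q \<in> kernel_class L"
  shows "prob_space Q" "sets Q = sets borel" "integrable (iid_pair Q) (\<lambda>(y, y'). L y y')"
  using assms unfolding kernel_class_def radon_prob_measure_def by auto

text \<open>
  The kernel is measurable only for the completed product. Fubini's theorem is applied to a
  product-measurable version of it instead.
\<close>
lemma product_version:
  assumes "Q \<in> kernel_class L"
  obtains f where "integrable (Q \<Otimes>\<^sub>M Q) f" "AE x in Q. AE y in Q. L x y = f (x, y)"
    "(\<integral>(z, z'). L z z' \<partial>iid_pair Q) = integral\<^sup>L (Q \<Otimes>\<^sub>M Q) f"
proof -
  interpret prob_space Q by (rule kernel_classD[OF assms])
  interpret pair_sigma_finite Q Q ..
  let ?M = "Q \<Otimes>\<^sub>M Q" and ?L = "\<lambda>(x, y). L x y"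
  have int: "integrable (completion ?M) ?L"
    using kernel_classD(3)[OF assms] by (simp add: iid_pair_def)
  then obtain f where f: "f \<in> borel_measurable ?M" and eq: "AE p in ?M. ?L p = f p"
    using completion_ex_borel_measurable_real[OF borel_measurable_integrable[OF int]] by blast
  have eq': "AE p in completion ?M. ?L p = f p"
    using eq by (rule AE_completion)
  have fc: "f \<in> borel_measurable (completion ?M)"
    using f by (rule measurable_completion)
  have "integrable (completion ?M) f"
    using int integrable_cong_AE[OF borel_measurable_integrable[OF int] fc eq'] by simp
  then have 1: "integrable ?M f"
    using f by (simp add: integrable_completion)
  have 2: "AE x in Q. AE y in Q. L x y = f (x, y)"
    using AE_pair[OF eq] by simp
  have 3: "integral\<^sup>L (iid_pair Q) ?L = integral\<^sup>L ?M f"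
    unfolding iid_pair_def
    using integral_cong_AE[OF borel_measurable_integrable[OF int] fc eq'] f
    by (simp add: integral_completion)
  show ?thesis by (rule that[OF 1 2 3])
qed

lemma measurable_left:
  assumes "sets Q = sets borel"
  shows "(\<lambda>z. L z y) \<in> borel_measurable Q"
  unfolding measurable_cong_sets[OF assms refl]
  by (rule borel_measurable_continuous_onI[OF continuous_on_left])

text \<open>
  Fubini's theorem yields integrability of almost every section \<open>L(\<sqdot>, w)\<close>, hence of one, and the
  quasi-triangle inequality transfers it from \<open>w\<close> to every \<open>y\<close>.
\<close>
lemma integrable_left:
  assumes "Q \<in> kernel_class L"
  shows "integrable Q (\<lambda>z. L z y)"
proof -
  interpret prob_space Q by (rule kernel_classD[OF assms])
  interpret pair_sigma_finite Q Q ..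
  note meas = measurable_left[OF kernel_classD(2)[OF assms]]
  obtain f where f: "integrable (Q \<Otimes>\<^sub>M Q) f" "AE x in Q. AE y in Q. L x y = f (x, y)"
    by (rule product_version[OF assms])
  have "AE x in Q. integrable Q (\<lambda>y. f (x, y))"
    using f(1) by (rule AE_integrable_fst')
  with f(2) have "AE x in Q. integrable Q (\<lambda>z. L z x)"
  proof eventually_elim
    case (elim x)
    have "integrable Q (\<lambda>z. L z x) \<longleftrightarrow> integrable Q (\<lambda>z. f (x, z))"
      using elim by (intro integrable_cong_AE meas) (auto simp: commute[of _ x])
    with elim show ?case by simp
  qed
  then obtain w where w: "integrable Q (\<lambda>z. L z w)"
    using eventually_happens'[OF ae_filter_bot] by blast
  show ?thesis
  proof (rule Bochner_Integration.integrable_bound)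
    show "integrable Q (\<lambda>z. 2 * L z w + 2 * L y w)"
      using w by simp
    show "AE z in Q. norm (L z y) \<le> norm (2 * L z w + 2 * L y w)"
      using quasi_triangle[of 1 _ y w] nonneg by simp
  qed (rule meas)
qed

lemma potential_nonneg: "0 \<le> potential Q y"
  unfolding potential_def by (simp add: nonneg)

lemma potential_quasi_triangle:
  assumes "Q \<in> kernel_class L" and "s > 0"
  shows "potential Q y \<le> (1 + 1 / s) * potential Q x + (1 + s) * L y x"
proof -
  interpret prob_space Q by (rule kernel_classD[OF assms(1)])
  note [simp] = integrable_left[OF assms(1)]
  have "potential Q y \<le> (\<integral>z. (1 + 1 / s) * L z x + (1 + s) * L y x \<partial>Q)"
    unfolding potential_def
    by (intro integral_mono quasi_triangle assms(2)) simp_all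
  also have "\<dots> = (1 + 1 / s) * potential Q x + (1 + s) * L y x"
    by (simp add: potential_def prob_space)
  finally show ?thesis .
qed

text \<open>
  By the integrated quasi-triangle inequality the potential is upper semicontinuous. Arguing with
  open sets, not sequences, matters because the space need not be first countable.
\<close>
lemma potential_measurable:
  assumes "Q \<in> kernel_class L"
  shows "potential Q \<in> borel_measurable borel"
proof -
  have "open {y. potential Q y < c}" for c
  proof (subst open_subopen, intro ballI)
    fix x assume "x \<in> {y. potential Q y < c}"
    then have x: "potential Q x < c" by simp
    \<comment> \<open>With \<open>g\<close> for the potential at \<open>x\<close>, any \<open>s > g / (c - g)\<close> works; the summand 1 makes \<open>s\<close> positive.\<close>
    obtain s where s: "s > 0" "(1 + 1 / s) * potential Q x < c"
    proof
      show "(potential Q x + 1) / (c - potential Q x) > 0"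
        using x potential_nonneg[of Q x] by (simp add: add_nonneg_pos)
      show "(1 + 1 / ((potential Q x + 1) / (c - potential Q x))) * potential Q x < c"
        using x potential_nonneg[of Q x] by (simp add: field_simps)
    qed
    let ?T = "{y. (1 + 1 / s) * potential Q x + (1 + s) * L y x < c}"
    have "open ?T"
      by (intro open_Collect_less continuous_intros continuous_on_left)
    moreover have "x \<in> ?T"
      using s by (simp add: diag)
    moreover have "?T \<subseteq> {y. potential Q y < c}"
      using potential_quasi_triangle[OF assms s(1)] by (auto intro: le_less_trans)
    ultimately show "\<exists>T. open T \<and> x \<in> T \<and> T \<subseteq> {y. potential Q y < c}"
      by blast
  qed
  then show ?thesis
    by (simp add: borel_measurable_iff_less)
qed

lemma potential_integrable:
  assumes "Q \<in> kernel_class L" and "P \<in> kernel_class L"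
  shows "integrable P (potential Q)"
proof -
  interpret prob_space P by (rule kernel_classD[OF assms(2)])
  obtain w where "w \<in> space P" using not_empty by blast
  show ?thesis
  proof (rule Bochner_Integration.integrable_bound)
    show "integrable P (\<lambda>y. 2 * potential Q w + 2 * L y w)"
      using integrable_left[OF assms(2)] by simp
    show "potential Q \<in> borel_measurable P"
      using potential_measurable[OF assms(1)] kernel_classD(2)[OF assms(2)]
      by (simp cong: measurable_cong_sets)
    show "AE y in P. norm (potential Q y) \<le> norm (2 * potential Q w + 2 * L y w)"
      using potential_quasi_triangle[OF assms(1), of 1 _ w] potential_nonneg nonneg by simp
  qed
qed

lemma integral_potential_self:
  assumes "Q \<in> kernel_class L"
  shows "(\<integral>y. potential Q y \<partial>Q) = (\<integral>(z, z'). L z z' \<partial>iid_pair Q)"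
proof -
  interpret prob_space Q by (rule kernel_classD[OF assms])
  interpret pair_sigma_finite Q Q ..
  obtain f where f: "integrable (Q \<Otimes>\<^sub>M Q) f" "AE x in Q. AE y in Q. L x y = f (x, y)"
    and eq: "(\<integral>(z, z'). L z z' \<partial>iid_pair Q) = integral\<^sup>L (Q \<Otimes>\<^sub>M Q) f"
    by (rule product_version[OF assms])
  have "AE x in Q. integrable Q (\<lambda>y. f (x, y))"
    using f(1) by (rule AE_integrable_fst')
  with f(2) have "AE x in Q. potential Q x = (\<integral>y. f (x, y) \<partial>Q)"
  proof eventually_elim
    case (elim x)
    then show ?case unfolding potential_def
      by (intro integral_cong_AE measurable_left[OF kernel_classD(2)[OF assms]])
        (auto simp: commute[of _ x])
  qed
  then have "(\<integral>y. potential Q y \<partial>Q) = (\<integral>x. \<integral>y. f (x, y) \<partial>Q \<partial>Q)"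
    using potential_integrable[OF assms assms] integrable_fst'[OF f(1)]
    by (intro integral_cong_AE) auto
  then show ?thesis
    using integral_fst'[OF f(1)] eq by simp
qed

section \<open>The energy inequality\<close>

lemma sum_symmetric_eq_twice_lower:
  fixes f :: "nat \<Rightarrow> nat \<Rightarrow> real"
  assumes "\<And>i j. f i j = f j i" and "\<And>i. f i i = 0"
  shows "(\<Sum>i<n. \<Sum>j<n. f i j) = 2 * (\<Sum>j<n. \<Sum>i<j. f i j)"
  by (induction n) (simp_all add: sum.distrib assms)

text \<open>
  The sum over \<open>i < j\<close> is affine in each point separately, because a point is never paired with
  itself. Hence replacing the points by independent random ones, one at a time, preserves the sign.
  The point with the smaller index is integrated first, which fixes the order of the integrals.
\<close>
lemma neg_def_integrated:
  fixes M :: "nat \<Rightarrow> 'a measure" and a :: "nat \<Rightarrow> real"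
  assumes M: "\<And>i. M i \<in> kernel_class L" and a: "(\<Sum>i<n. a i) = 0"
  shows "(\<Sum>j<n. \<Sum>i<j. a i * a j * (\<integral>y. potential (M i) y \<partial>M j)) \<le> 0"
proof -
  \<comment> \<open>The value of the pair \<open>i < j\<close> after the points with index below \<open>k\<close> have been integrated out.\<close>
  define h where "h k y i j =
    (if j < k then \<integral>z. potential (M i) z \<partial>M j
     else if i < k then potential (M i) (y j) else L (y i) (y j))"
    for k y and i j :: nat
  have "(\<Sum>j<n. \<Sum>i<j. a i * a j * h k y i j) \<le> 0" for k y
  proof (induction k arbitrary: y)
    case 0
    have "2 * (\<Sum>j<n. \<Sum>i<j. a i * a j * L (y i) (y j)) =
        (\<Sum>i<n. \<Sum>j<n. a i * a j * L (y i) (y j))"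
      by (rule sum_symmetric_eq_twice_lower[symmetric]) (auto simp: diag commute)
    also have "\<dots> \<le> 0"
      by (rule neg_def_sum[OF a])
    finally show ?case by (simp add: h_def)
  next
    case (Suc k)
    interpret prob_space "M k" by (rule kernel_classD[OF M])
    have step: "has_bochner_integral (M k) (\<lambda>z. h k (y(k := z)) i j) (h (Suc k) y i j)"
      if "i < j" for i j
    proof -
      consider "j < k" | "j = k" | "i < k" "k < j" | "i = k" | "k < i" using that by linarith
      then show ?thesis
      proof cases
        case 2
        with that show ?thesis
          by (simp add: h_def has_bochner_integral_integrable potential_integrable[OF M M])
      next
        case 4
        with that show ?thesis
          using integrable_left[OF M]
          by (simp add: h_def has_bochner_integral_integrable potential_def)
      qed (use that in \<open>simp_all add: h_def has_bochner_integral_iff prob_space\<close>)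
    qed
    have "has_bochner_integral (M k) (\<lambda>z. \<Sum>j<n. \<Sum>i<j. a i * a j * h k (y(k := z)) i j)
        (\<Sum>j<n. \<Sum>i<j. a i * a j * h (Suc k) y i j)"
      by (intro has_bochner_integral_sum has_bochner_integral_mult_right step) simp
    then show ?case
      using integral_le_const[of "\<lambda>z. \<Sum>j<n. \<Sum>i<j. a i * a j * h k (y(k := z)) i j" 0] Suc.IH
      by (simp add: has_bochner_integral_iff)
  qed
  from this[of n undefined] show ?thesis
    by (simp add: h_def)
qed

text \<open>
  The sample of size \<open>2 * n\<close> loses only the diagonal terms, a fraction \<open>1 / n\<close> of the left-hand
  side, so the inequality holds in the limit of large \<open>n\<close>.
\<close>
lemma energy_inequality:
  assumes P: "P \<in> kernel_class L" and Q: "Q \<in> kernel_class L"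
  shows "(\<integral>y. potential P y \<partial>P) + (\<integral>y. potential Q y \<partial>Q) \<le> 2 * (\<integral>y. potential Q y \<partial>P)"
proof -
  define A B C where "A = (\<integral>y. potential P y \<partial>P)" and "B = (\<integral>y. potential Q y \<partial>Q)"
    and "C = (\<integral>y. potential Q y \<partial>P)"
  have ineq: "real n * (A + B - 2 * C) \<le> A + B" for n :: nat
  proof (cases "n = 0")
    case True
    have "0 \<le> A" "0 \<le> B" unfolding A_def B_def by (simp_all add: potential_nonneg)
    with True show ?thesis by simp
  next
    case False
    \<comment> \<open>The points from \<open>Q\<close> get the smaller indices, so every mixed pair contributes \<open>C\<close>.\<close>
    define M where "M i = (if i < n then Q else P)" for i
    define a where "a i = (if i < n then 1 else - 1 :: real)" for i
    define E where "E i j = a i * a j * (\<integral>y. potential (M i) y \<partial>M j)" for i j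
    have row: "(\<Sum>i<n + k. a i) = real n - real k" for k
      by (induction k) (simp_all add: a_def)
    have left: "(\<Sum>j<k. \<Sum>i<j. E i j) = real k * (real k - 1) / 2 * B" if "k \<le> n" for k
      using that by (induction k) (simp_all add: E_def a_def M_def B_def field_simps)
    have col: "(\<Sum>i<n + k. E i (n + k)) = real k * A - real n * C" for k
    proof -
      have "(\<Sum>i<n + m. E i (n + k)) = real m * A - real n * C" for m
        by (induction m) (simp_all add: E_def a_def M_def A_def C_def algebra_simps)
      then show ?thesis .
    qed
    have total: "(\<Sum>j<n + k. \<Sum>i<j. E i j) = real n * (real n - 1) / 2 * B
        + real k * (real k - 1) / 2 * A - real k * real n * C" for k
    proof (induction k)
      case 0
      show ?case by (simp add: left)
    next
      case (Suc k)
      then show ?case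
        unfolding add_Suc_right sum.lessThan_Suc col by (simp add: field_simps)
    qed
    have "(\<Sum>j<n + n. \<Sum>i<j. E i j) \<le> 0"
      unfolding E_def using row[of n] P Q by (intro neg_def_integrated) (auto simp: M_def)
    then have "real n * (real n * (A + B - 2 * C)) \<le> real n * (A + B)"
      unfolding total by (simp add: field_simps)
    then show ?thesis using False by simp
  qed
  have "A + B - 2 * C \<le> 0"
  proof (rule ccontr)
    assume "\<not> A + B - 2 * C \<le> 0"
    then obtain n where "A + B < real n * (A + B - 2 * C)"
      using reals_Archimedean3[of "A + B - 2 * C"] by auto
    with ineq[of n] show False by simp
  qed
  then show ?thesis
    by (simp add: A_def B_def C_def)
qed

section \<open>Kernel scores\<close>

lemma expected_kernel_score:
  assumes P: "P \<in> kernel_class L" and Q: "Q \<in> kernel_class L"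
  shows "(\<integral>y. kernel_score L Q y \<partial>P) =
    (\<integral>y. potential Q y \<partial>P) - 1 / 2 * (\<integral>y. potential Q y \<partial>Q)"
proof -
  interpret prob_space P by (rule kernel_classD[OF P])
  have "kernel_score L Q = (\<lambda>y. potential Q y - 1 / 2 * (\<integral>y. potential Q y \<partial>Q))"
    by (simp add: fun_eq_iff kernel_score_def integral_potential_self[OF Q] flip: potential_def)
  then show ?thesis
    using potential_integrable[OF Q P] by (simp add: prob_space)
qed

text \<open>
  The square of a Dirac measure is concentrated at the measurable point \<open>(y, y)\<close>, where \<open>L\<close>
  vanishes; so the energy term of the score is 0.
\<close>
lemma kernel_score_dirac: "kernel_score L (return borel y) y' = L y y'"
proof -
  let ?D = "return borel y"
  interpret D: prob_space ?D by (rule prob_space_return) simp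
  interpret pair_sigma_finite ?D ?D ..
  have "AE p in ?D \<Otimes>\<^sub>M ?D. (\<lambda>(z, z'). L z z') p = 0"
  proof (rule AE_I)
    have yy: "{y} \<times> {y} \<in> sets (?D \<Otimes>\<^sub>M ?D)"
      by (intro pair_measureI) simp_all
    then show "space (?D \<Otimes>\<^sub>M ?D) - {y} \<times> {y} \<in> sets (?D \<Otimes>\<^sub>M ?D)"
      by (rule sets.compl_sets)
    have "emeasure (?D \<Otimes>\<^sub>M ?D) ({y} \<times> {y}) = 1"
      by (subst D.emeasure_pair_measure_Times) (simp_all)
    moreover have "prob_space (?D \<Otimes>\<^sub>M ?D)"
      by (rule prob_space_pair) (rule D.prob_space_axioms)+
    ultimately show "emeasure (?D \<Otimes>\<^sub>M ?D) (space (?D \<Otimes>\<^sub>M ?D) - {y} \<times> {y}) = 0"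
      using emeasure_compl[OF yy] by (simp add: prob_space.emeasure_space_1)
  qed (auto simp: diag)
  then have "(\<integral>(z, z'). L z z' \<partial>iid_pair ?D) = 0"
    unfolding iid_pair_def by (intro integral_eq_zero_AE AE_completion)
  moreover have "(\<integral>z. L z y' \<partial>?D) = L y y'"
    using measurable_left[OF refl] by (intro integral_return) simp_all
  ultimately show ?thesis
    by (simp add: kernel_score_def)
qed

end

theorem mainTheorem4:
  fixes L :: "'a::t2_space \<Rightarrow> 'a \<Rightarrow> real"
    and P :: "'a measure"
    and \<alpha> \<beta> :: ereal
  assumes "continuous_on UNIV (\<lambda>(x, y). L x y)"
    and "neg_def_kernel L"
    and "P \<in> kernel_class L"
    and "\<alpha> = (INF Q\<in>kernel_class L. ereal (\<integral>y'. kernel_score L Q y' \<partial>P))"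
    and "\<beta> = ereal (\<integral>(y, y'). kernel_score L (return borel y) y' \<partial>iid_pair P)"
  shows "\<alpha> = ereal (\<integral>y'. kernel_score L P y' \<partial>P) \<and> \<alpha> \<le> \<beta> \<and> \<beta> = 2 * \<alpha>"
proof -
  interpret continuous_neg_def_kernel L
    by unfold_locales (fact assms)+
  let ?A = "\<integral>y. potential P y \<partial>P"
  have score_P: "(\<integral>y. kernel_score L P y \<partial>P) = ?A / 2"
    by (simp add: expected_kernel_score[OF assms(3) assms(3)])
  have "(\<integral>y. kernel_score L P y \<partial>P) \<le> (\<integral>y. kernel_score L Q y \<partial>P)"
    if "Q \<in> kernel_class L" for Q
    using energy_inequality[OF assms(3) that]
    by (simp add: expected_kernel_score[OF assms(3)] that assms(3))
  then have \<alpha>: "\<alpha> = ereal (\<integral>y. kernel_score L P y \<partial>P)"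
    unfolding assms(4) using assms(3)
    by (intro antisym INF_lower INF_greatest) simp_all
  have \<beta>: "\<beta> = ereal ?A"
    by (simp add: assms(5) kernel_score_dirac integral_potential_self[OF assms(3)])
  have "0 \<le> ?A"
    by (simp add: potential_nonneg)
  then show ?thesis
    by (simp add: \<alpha> \<beta> score_P)
qed

end
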